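(* Let $\tau_p\in\{K_{tot},\dots,T\}$ be fixed, let $N>K_{tot}$, and consider the max-min fairness problem $$\max_{\{p_{jk}^u\},\{p_{jk}^{dl}\}}\ \min_{j\in\mathcal{G}}\ \min_{k\in\mathcal{K}_j}\ \mathrm{SINR}_{jk}\quad\text{s.t.}\quad 0\le p_{jk}^u\le p_{jk}^{utot},\quad p_{jk}^{dl}\ge 0\quad(\forall j\in\mathcal{G},\ k\in\mathcal{K}_j),\quad \sum_{j=1}^{G}\sum_{k=1}^{K_j}p_{jk}^{dl}=P,$$ where $P=P_{tot}>0$ is the total power available at the base station, $p_{jk}^{utot}>0$ are given pilot power limits, and $$\mathrm{SINR}_{ik}=\frac{(N-K_{tot})\,\gamma_{ik}\,p_{ik}^{dl}}{1+(\beta_{ik}-\gamma_{ik})P},\qquad \gamma_{ik}=\frac{\tau_p p_{ik}^u\beta_{ik}^2}{1+\tau_p p_{ik}^u\beta_{ik}}.$$ Then at the optimal solution all users have the same SINR, i.e. $\mathrm{SINR}_{ik}=\Gamma$ for all $i\in\mathcal{G}$, $k\in\mathcal{K}_i$, and $$\Gamma=\frac{(N-K_{tot})P}{\sum_{i=1}^{G}\sum_{k=1}^{K_i}\frac{1+(\beta_{ik}-\gamma_{ik}^* )P}{\gamma_{ik}^*}},\qquad\text{where }\ \gamma_{ik}^*=\frac{\tau_p p_{ik}^{utot}\beta_{ik}^2}{1+\tau_p p_{ik}^{utot}\beta_{ik}}.$$ The optimal uplink training and downlink transmission powers of user $k$ in group $i$ are $$p_{ik}^{u*}=p_{ik}^{utot},\qquad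 p_{ik}^{dl*}=\frac{1+(\beta_{ik}-\gamma_{ik}^* )P}{\gamma_{ik}^*(N-K_{tot})}\,\Gamma.$$
   Context: $G\ge 1$ is the number of multicast groups, $\mathcal{G}=\{1,\dots,G\}$; group $j$ has $K_j\ge 1$ users indexed by $\mathcal{K}_j=\{1,\dots,K_j\}$, and $K_{tot}=\sum_{j=1}^{G}K_j$. $N$ is the number of base station antennas, $T$ is the coherence interval length in symbols, $\tau_p$ is the pilot length, and $\beta_{jk}>0$ is the given large-scale fading coefficient of user $k$ in group $j$. $p_{jk}^u$ and $p_{jk}^{dl}$ denote the uplink pilot power and the downlink power of that user. $\mathrm{SINR}_{ik}$ is the effective SINR of user $k$ in group $i$ when the zero-forcing unicast precoder is used; for the claim only its displayed formula is needed. *)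

theory Defs
  imports Complex_Main
begin

text \<open>
  Groups are indexed by \<open>{1..G}\<close> and the users of group \<open>j\<close> by \<open>{1..K j}\<close>. Quantities attached to
  user \<open>k\<close> of group \<open>j\<close> are functions \<open>nat \<Rightarrow> nat \<Rightarrow> real\<close>, whose values outside these ranges are
  irrelevant.
\<close>

definition K_tot :: "nat \<Rightarrow> (nat \<Rightarrow> nat) \<Rightarrow> nat" where
  "K_tot G K = (\<Sum>j = 1..G. K j)"

definition chan_gamma ::
  "nat \<Rightarrow> (nat \<Rightarrow> nat \<Rightarrow> real) \<Rightarrow> (nat \<Rightarrow> nat \<Rightarrow> real) \<Rightarrow> nat \<Rightarrow> nat \<Rightarrow> real" where
  "chan_gamma \<tau> \<beta> pu i k = real \<tau> * pu i k * (\<beta> i k)\<^sup>2 / (1 + real \<tau> * pu i k * \<beta> i k)"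

definition SINR ::
  "nat \<Rightarrow> nat \<Rightarrow> (nat \<Rightarrow> nat) \<Rightarrow> nat \<Rightarrow> (nat \<Rightarrow> nat \<Rightarrow> real) \<Rightarrow> real \<Rightarrow>
    (nat \<Rightarrow> nat \<Rightarrow> real) \<Rightarrow> (nat \<Rightarrow> nat \<Rightarrow> real) \<Rightarrow> nat \<Rightarrow> nat \<Rightarrow> real" where
  "SINR N G K \<tau> \<beta> P pu pdl i k =
    (real N - real (K_tot G K)) * chan_gamma \<tau> \<beta> pu i k * pdl i k /
      (1 + (\<beta> i k - chan_gamma \<tau> \<beta> pu i k) * P)"

definition min_SINR ::
  "nat \<Rightarrow> nat \<Rightarrow> (nat \<Rightarrow> nat) \<Rightarrow> nat \<Rightarrow> (nat \<Rightarrow> nat \<Rightarrow> real) \<Rightarrow> real \<Rightarrow>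
    (nat \<Rightarrow> nat \<Rightarrow> real) \<Rightarrow> (nat \<Rightarrow> nat \<Rightarrow> real) \<Rightarrow> real" where
  "min_SINR N G K \<tau> \<beta> P pu pdl = (MIN j\<in>{1..G}. MIN k\<in>{1..K j}. SINR N G K \<tau> \<beta> P pu pdl j k)"

definition feasible ::
  "nat \<Rightarrow> (nat \<Rightarrow> nat) \<Rightarrow> real \<Rightarrow> (nat \<Rightarrow> nat \<Rightarrow> real) \<Rightarrow>
    (nat \<Rightarrow> nat \<Rightarrow> real) \<Rightarrow> (nat \<Rightarrow> nat \<Rightarrow> real) \<Rightarrow> bool" where
  "feasible G K P putot pu pdl \<longleftrightarrow>
    (\<forall>j\<in>{1..G}. \<forall>k\<in>{1..K j}. 0 \<le> pu j k \<and> pu j k \<le> putot j k \<and> 0 \<le> pdl j k) \<and>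
    (\<Sum>j = 1..G. \<Sum>k = 1..K j. pdl j k) = P"

definition mmf_optimal ::
  "nat \<Rightarrow> nat \<Rightarrow> (nat \<Rightarrow> nat) \<Rightarrow> nat \<Rightarrow> (nat \<Rightarrow> nat \<Rightarrow> real) \<Rightarrow> real \<Rightarrow> (nat \<Rightarrow> nat \<Rightarrow> real) \<Rightarrow>
    (nat \<Rightarrow> nat \<Rightarrow> real) \<Rightarrow> (nat \<Rightarrow> nat \<Rightarrow> real) \<Rightarrow> bool" where
  "mmf_optimal N G K \<tau> \<beta> P putot pu pdl \<longleftrightarrow>
    is_arg_max (\<lambda>(qu, qdl). min_SINR N G K \<tau> \<beta> P qu qdl)
      (\<lambda>(qu, qdl). feasible G K P putot qu qdl) (pu, pdl)"

end

theory Submission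
  imports Defs
begin

text \<open>
  At fixed power budget, the SINR of a user is proportional to its downlink power divided by a cost
  that strictly decreases in its pilot power. If every SINR is at least \<open>\<Gamma>\<close>, then every downlink
  power is at least \<open>\<Gamma>\<close> times the cost at full pilot power, up to the common factor. As \<open>\<Gamma>\<close> is chosen
  so that these lower bounds already add up to \<open>P\<close>, all of them are equalities, which forces full
  pilot power.
\<close>

definition user_cost ::
  "nat \<Rightarrow> (nat \<Rightarrow> nat \<Rightarrow> real) \<Rightarrow> real \<Rightarrow> (nat \<Rightarrow> nat \<Rightarrow> real) \<Rightarrow> nat \<Rightarrow> nat \<Rightarrow> real" where
  "user_cost \<tau> \<beta> P pu i k =
    (1 + (\<beta> i k - chan_gamma \<tau> \<beta> pu i k) * P) / chan_gamma \<tau> \<beta> pu i k"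

text \<open>If \<open>pu i k = 0\<close>, the cost has the junk value 0 and both sides vanish.\<close>

lemma SINR_eq_cost:
  "SINR N G K \<tau> \<beta> P pu pdl i k =
    (real N - real (K_tot G K)) * pdl i k / user_cost \<tau> \<beta> P pu i k"
  by (simp add: SINR_def user_cost_def mult_ac)

text \<open>The factor \<open>1 + \<tau> * pu i k * \<beta> i k\<close> cancels from the quotient,
  which leaves the pilot power in a single denominator. Positivity and strict monotonicity can then
  be read off.\<close>

lemma user_cost_eq:
  assumes "\<tau> > 0" "\<beta> i k > 0" "pu i k > 0"
  shows "user_cost \<tau> \<beta> P pu i k =
    1 / \<beta> i k + (1 + \<beta> i k * P) / (real \<tau> * (\<beta> i k)\<^sup>2 * pu i k)"
proof -
  define b x t where "b = \<beta> i k" and "x = pu i k" and "t = real \<tau>"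
  have pos: "b > 0" "x > 0" "t > 0" and D: "1 + t * x * b > 0"
    using assms by (auto simp: b_def x_def t_def intro!: add_pos_pos)
  \<comment> \<open>The difference \<beta> - \<gamma> has the same denominator as \<gamma> itself,
    which is what makes the cancellation below possible.\<close>
  have g: "b - t * x * b\<^sup>2 / (1 + t * x * b) = b / (1 + t * x * b)"
    using D by (simp add: field_simps power2_eq_square)
  have "user_cost \<tau> \<beta> P pu i k = (1 + b / (1 + t * x * b) * P) / (t * x * b\<^sup>2 / (1 + t * x * b))"
    unfolding user_cost_def chan_gamma_def b_def[symmetric] x_def[symmetric] t_def[symmetric] g ..
  also have "1 + b / (1 + t * x * b) * P = (1 + t * x * b + b * P) / (1 + t * x * b)"
    using D by (simp add: field_simps)
  also have "\<dots> / (t * x * b\<^sup>2 / (1 + t * x * b)) = (1 + t * x * b + b * P) / (t * x * b\<^sup>2)"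
    using D by simp
  also have "\<dots> = 1 / b + (1 + b * P) / (t * b\<^sup>2 * x)"
    using pos by (simp add: field_simps power2_eq_square)
  finally show ?thesis by (simp add: b_def x_def t_def)
qed

lemma user_cost_pos:
  assumes "\<tau> > 0" "\<beta> i k > 0" "pu i k > 0" "P > 0"
  shows "user_cost \<tau> \<beta> P pu i k > 0"
  using assms by (simp add: user_cost_eq add_pos_pos)

lemma user_cost_strict_antimono:
  assumes "\<tau> > 0" "\<beta> i k > 0" "pu i k > 0" "P > 0" "pu i k < pu' i k"
  shows "user_cost \<tau> \<beta> P pu' i k < user_cost \<tau> \<beta> P pu i k"
  using assms by (simp add: user_cost_eq divide_strict_left_mono add_pos_pos)

text \<open>The argument for a single user: the bound on its downlink power, and the equality case
  that pins down its pilot power.\<close>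

lemma pdl_ge_of_SINR_ge:
  fixes c :: real
  assumes "\<tau> > 0" "\<beta> i k > 0" "P > 0" "c > 0" "\<Gamma> > 0"
    and pu: "0 \<le> pu i k" "pu i k \<le> putot i k"
    and le: "\<Gamma> \<le> c * p / user_cost \<tau> \<beta> P pu i k"
  shows "user_cost \<tau> \<beta> P putot i k / c * \<Gamma> \<le> p"
    and "p = user_cost \<tau> \<beta> P putot i k / c * \<Gamma> \<Longrightarrow> pu i k = putot i k"
proof -
  \<comment> \<open>Zero pilot power gives \<gamma> = 0, so the cost and then the right-hand side of
    \<open>le\<close> are divisions by zero with value 0, against \<Gamma> > 0.\<close>
  have "pu i k \<noteq> 0"
    using le \<open>\<Gamma> > 0\<close> by (auto simp: user_cost_def chan_gamma_def)
  then have "pu i k > 0" using pu by simp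
  then have "user_cost \<tau> \<beta> P pu i k > 0" using assms by (simp add: user_cost_pos)
  then have p: "user_cost \<tau> \<beta> P pu i k / c * \<Gamma> \<le> p"
    using le \<open>c > 0\<close> by (simp add: field_simps)
  have strict: "user_cost \<tau> \<beta> P putot i k / c * \<Gamma> < p" if "pu i k < putot i k"
  proof -
    have "user_cost \<tau> \<beta> P putot i k / c * \<Gamma> < user_cost \<tau> \<beta> P pu i k / c * \<Gamma>"
      using user_cost_strict_antimono[where pu = pu and pu' = putot and i = i and k = k] assms
        \<open>pu i k > 0\<close> that
      by (intro mult_strict_right_mono divide_strict_right_mono)
    with p show ?thesis by simp
  qed
  have "user_cost \<tau> \<beta> P putot i k = user_cost \<tau> \<beta> P pu i k" if "pu i k = putot i k"
    using that by (simp add: user_cost_def chan_gamma_def)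
  then show "user_cost \<tau> \<beta> P putot i k / c * \<Gamma> \<le> p"
    using p strict pu by fastforce
  show "pu i k = putot i k" if "p = user_cost \<tau> \<beta> P putot i k / c * \<Gamma>"
    using strict pu that by fastforce
qed

text \<open>The assumptions make all index ranges nonempty, so both nested minima are
  attained.\<close>

lemma le_min_SINR_iff:
  assumes "G \<ge> 1" "\<forall>j\<in>{1..G}. K j \<ge> 1"
  shows "x \<le> min_SINR N G K \<tau> \<beta> P pu pdl \<longleftrightarrow>
    (\<forall>j\<in>{1..G}. \<forall>k\<in>{1..K j}. x \<le> SINR N G K \<tau> \<beta> P pu pdl j k)"
  using assms by (simp add: min_SINR_def)

lemma min_SINR_const:
  assumes "G \<ge> 1" "\<forall>j\<in>{1..G}. K j \<ge> 1"
    and "\<forall>j\<in>{1..G}. \<forall>k\<in>{1..K j}. SINR N G K \<tau> \<beta> P pu pdl j k = x"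
  shows "min_SINR N G K \<tau> \<beta> P pu pdl = x"
proof (rule antisym)
  have "(1::nat) \<in> {1..G}" "(1::nat) \<in> {1..K 1}" using assms(1,2) by auto
  then show "min_SINR N G K \<tau> \<beta> P pu pdl \<le> x"
    using le_min_SINR_iff[OF assms(1,2)] assms(3) by (metis order_refl)
  show "x \<le> min_SINR N G K \<tau> \<beta> P pu pdl"
    using le_min_SINR_iff[OF assms(1,2)] assms(3) by simp
qed

theorem theorem3:
  fixes G N T \<tau> :: nat and K :: "nat \<Rightarrow> nat"
    and \<beta> putot \<gamma>opt pdlopt :: "nat \<Rightarrow> nat \<Rightarrow> real"
    and P \<Gamma> :: real
  assumes "G \<ge> 1"
    and "\<forall>j\<in>{1..G}. K j \<ge> 1"
    and "\<tau> \<in> {K_tot G K..T}"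
    and "N > K_tot G K"
    and "P > 0"
    and "\<forall>j\<in>{1..G}. \<forall>k\<in>{1..K j}. \<beta> j k > 0"
    and "\<forall>j\<in>{1..G}. \<forall>k\<in>{1..K j}. putot j k > 0"
    and \<gamma>opt: "\<gamma>opt = chan_gamma \<tau> \<beta> putot"
    and \<Gamma>: "\<Gamma> = (real N - real (K_tot G K)) * P /
        (\<Sum>i = 1..G. \<Sum>k = 1..K i. (1 + (\<beta> i k - \<gamma>opt i k) * P) / \<gamma>opt i k)"
    and pdlopt: "pdlopt = (\<lambda>i k. (1 + (\<beta> i k - \<gamma>opt i k) * P) /
        (\<gamma>opt i k * (real N - real (K_tot G K))) * \<Gamma>)"
  shows "mmf_optimal N G K \<tau> \<beta> P putot putot pdlopt \<and>
    (\<forall>pu pdl. mmf_optimal N G K \<tau> \<beta> P putot pu pdl \<longrightarrow>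
      (\<forall>i\<in>{1..G}. \<forall>k\<in>{1..K i}.
        SINR N G K \<tau> \<beta> P pu pdl i k = \<Gamma> \<and>
        pu i k = putot i k \<and>
        pdl i k = pdlopt i k))"
proof -
  define c where "c = real N - real (K_tot G K)"
  define a where "a = user_cost \<tau> \<beta> P putot"
  \<comment> \<open>Flattening the users into one finite index set turns the double sums into single
    ones, to which the termwise comparison below applies.\<close>
  define I where "I = (SIGMA i:{1..G}. {1..K i})"
  note G = assms(1) and K = assms(2)
  have c: "c > 0" using assms(4) by (simp add: c_def)
  have one: "(1, 1) \<in> I" using G K by (auto simp: I_def)
  \<comment> \<open>Positivity of the pilot length comes from \<tau> \<ge> \<open>K_tot G K\<close>
    \<ge> \<open>K 1\<close> \<ge> 1.\<close>
  have "K 1 \<le> K_tot G K"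
    unfolding K_tot_def by (rule member_le_sum) (use G in auto)
  moreover have "K 1 \<ge> 1" using G K by simp
  ultimately have \<tau>: "\<tau> > 0" using assms(3) by simp
  have a_pos: "a i k > 0" if "(i, k) \<in> I" for i k
    using that assms \<tau> unfolding a_def I_def by (auto intro!: user_cost_pos)
  have \<Gamma>_eq: "\<Gamma> = c * P / (\<Sum>(i, k)\<in>I. a i k)"
    by (simp add: \<Gamma> \<gamma>opt a_def user_cost_def c_def I_def sum.Sigma)
  have pdlopt_eq: "pdlopt i k = a i k / c * \<Gamma>" for i k
    by (simp add: pdlopt \<gamma>opt a_def user_cost_def c_def)
  have S: "(\<Sum>(i, k)\<in>I. a i k) > 0"
  proof (rule sum_pos)
    show "finite I" by (simp add: I_def)
    show "I \<noteq> {}" using one by blast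
  qed (use a_pos in auto)
  have \<Gamma>_pos: "\<Gamma> > 0" using S c \<open>P > 0\<close> by (simp add: \<Gamma>_eq)
  have "(\<Sum>(i, k)\<in>I. pdlopt i k) = (\<Sum>(i, k)\<in>I. a i k) / c * \<Gamma>"
    by (simp add: pdlopt_eq sum_distrib_right sum_divide_distrib case_prod_unfold)
  also have "\<dots> = P" using S c by (simp add: \<Gamma>_eq)
  finally have sum_opt: "(\<Sum>(i, k)\<in>I. pdlopt i k) = P" .
  have SINR_opt: "SINR N G K \<tau> \<beta> P putot pdlopt i k = \<Gamma>" if "(i, k) \<in> I" for i k
    using a_pos[OF that] c unfolding SINR_eq_cost a_def[symmetric] c_def[symmetric] pdlopt_eq
    by simp
  have min_opt: "min_SINR N G K \<tau> \<beta> P putot pdlopt = \<Gamma>"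
    using SINR_opt by (intro min_SINR_const[OF G K]) (auto simp: I_def)
  have feas_opt: "feasible G K P putot putot pdlopt"
    using sum_opt a_pos c \<Gamma>_pos assms(7)
    by (auto simp: feasible_def I_def sum.Sigma pdlopt_eq less_imp_le)
  \<comment> \<open>Assuming only a minimum of at least \<Gamma>, rather than optimality, lets this
    fact serve both for the upper bound \<open>max\<close> and for uniqueness.\<close>
  have unique: "pu i k = putot i k \<and> pdl i k = pdlopt i k \<and> SINR N G K \<tau> \<beta> P pu pdl i k = \<Gamma>"
    if feas: "feasible G K P putot pu pdl" and ge: "\<Gamma> \<le> min_SINR N G K \<tau> \<beta> P pu pdl"
      and ik: "(i, k) \<in> I" for pu pdl i k
  proof -
    have SINR_ge: "\<Gamma> \<le> c * pdl i k / user_cost \<tau> \<beta> P pu i k" if "(i, k) \<in> I" for i k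
      using ge that unfolding le_min_SINR_iff[OF G K] SINR_eq_cost c_def I_def by auto
    have bounds: "\<beta> i k > 0" "0 \<le> pu i k" "pu i k \<le> putot i k" if "(i, k) \<in> I" for i k
      using that feas assms(6) by (auto simp: feasible_def I_def)
    have user: "pdlopt i k \<le> pdl i k" "pdl i k = pdlopt i k \<Longrightarrow> pu i k = putot i k"
      if "(i, k) \<in> I" for i k
      using pdl_ge_of_SINR_ge[where i = i and k = k and pu = pu and putot = putot and p = "pdl i k"]
        \<tau> \<open>P > 0\<close> c \<Gamma>_pos bounds[OF that] SINR_ge[OF that]
      unfolding pdlopt_eq a_def by blast+
    have "(\<Sum>(i, k)\<in>I. pdl i k) = P"
      using feas by (simp add: feasible_def I_def sum.Sigma)
    \<comment> \<open>Both allocations sum to \<open>P\<close> and one dominates the other termwise,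
      so no term can be strictly larger.\<close>
    then have pdl: "pdl i k = pdlopt i k"
      using sum_mono_inv[of "\<lambda>(i, k). pdlopt i k" I "\<lambda>(i, k). pdl i k" "(i, k)"]
        user(1) sum_opt ik by (auto simp: I_def)
    then have pu: "pu i k = putot i k"
      using user(2) ik by blast
    have "SINR N G K \<tau> \<beta> P pu pdl i k = SINR N G K \<tau> \<beta> P putot pdlopt i k"
      using pdl pu by (simp add: SINR_def chan_gamma_def)
    with pdl pu SINR_opt[OF ik] show ?thesis by simp
  qed
  \<comment> \<open>A minimum above \<Gamma> would fall under \<open>unique\<close>, which makes
    every SINR, and hence the minimum, equal to \<Gamma>.\<close>
  have max: "min_SINR N G K \<tau> \<beta> P pu pdl \<le> \<Gamma>" if "feasible G K P putot pu pdl" for pu pdl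
  proof (rule ccontr)
    assume "\<not> ?thesis"
    then have "min_SINR N G K \<tau> \<beta> P pu pdl > \<Gamma>" by simp
    moreover from this have "min_SINR N G K \<tau> \<beta> P pu pdl = \<Gamma>"
      using unique[OF that] by (intro min_SINR_const[OF G K]) (auto simp: I_def)
    ultimately show False by simp
  qed
  have "mmf_optimal N G K \<tau> \<beta> P putot putot pdlopt"
    using feas_opt max by (force simp: mmf_optimal_def is_arg_max_def min_opt)
  \<comment> \<open>An optimal allocation does at least as well as the feasible
    \<open>pdlopt\<close> with full pilot power, whose value is \<Gamma>; so \<open>unique\<close>
    applies to it.\<close>
  moreover have "feasible G K P putot pu pdl" "\<Gamma> \<le> min_SINR N G K \<tau> \<beta> P pu pdl"
    if "mmf_optimal N G K \<tau> \<beta> P putot pu pdl" for pu pdl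
    using that feas_opt min_opt by (auto simp: mmf_optimal_def is_arg_max_def not_less)
  ultimately show ?thesis
    using unique unfolding I_def by blast
qed

end
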